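(* Let $(X,\mathcal{F},\mu)$ be a measure space, $\varphi:X\to X$ a non-singular measurable transformation, and $u:X\to\mathbb{C}$ a positive measurable function. Let $W=uC_\varphi$, $Wf=u\cdot(f\circ\varphi)$, be a bounded operator on $L^2(\mu)$ and $m\in\mathbb{N}$. Then $W$ is quasi-$m$-isometry if and only if $$G_m=\sum_{k=0}^{m}(-1)^{m-k}\binom{m}{k}J_{k+1}=0\quad \mu\text{-a.e.},$$ in which $J_0=1$ and $J_n=h_nE_n(|u_n|^2)\circ\varphi^{-n}=hE(J_{n-1}|u|^2)\circ\varphi^{-1}$ for $n\ge 1$. Moreover, $W$ is $m$-isometry if and only if $$G^0_m=\sum_{k=0}^{m}(-1)^{m-k}\binom{m}{k}J_{k}=0\quad \mu\text{-a.e.}$$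
   Context: A bounded operator $T$ on a complex Hilbert space is called $m$-isometry if $B_m=\sum_{k=0}^{m}(-1)^{m-k}\binom{m}{k}T^{*k}T^{k}=0$, and quasi-$m$-isometry if $T^*B_mT=\sum_{k=0}^{m}(-1)^{m-k}\binom{m}{k}T^{*(k+1)}T^{k+1}=0$. The map $\varphi$ is non-singular if $\mu\circ\varphi^{-1}\ll\mu$. For $n\ge1$: $h_n=\frac{d\mu\circ\varphi^{-n}}{d\mu}$ is the Radon–Nikodym derivative, $h=h_1$; $E_n$ is the conditional expectation with respect to the sub-$\sigma$-algebra $\varphi^{-n}(\mathcal{F})$ of $\mathcal F$, $E=E_1$; $u_n=\prod_{k=0}^{n-1}u\circ\varphi^k$. When $E_n(f)=g\circ\varphi^n$ with $g$ measurable, $E_n(f)\circ\varphi^{-n}$ denotes $g$.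
   Formalization: The measure μ is assumed σ-finite, and so is its restriction to φ^{-n}(F) for every n≥1, so that h_n and E_n exist and are determined; for arbitrary measure spaces the claim fails (one point of infinite mass, φ=id, u=2). *)

theory Defs
  imports "HOL-Probability.Conditional_Expectation" "HOL-Library.Nonpos_Ints"
begin

section \<open>The complex Hilbert space of square-integrable functions\<close>

text \<open>
  Elements of \<open>L\<^sup>2(\<mu>)\<close> are represented by square-integrable functions and equality of
  elements is equality almost everywhere; no quotient is formed. Accordingly all equations
  between elements, and hence between operators, are stated up to \<open>AE\<close>.
\<close>

definition L2_space :: "'a measure \<Rightarrow> ('a \<Rightarrow> complex) set" where
  "L2_space M = {f \<in> borel_measurable M. integrable M (\<lambda>x. (cmod (f x))\<^sup>2)}"

definition L2_inner :: "'a measure \<Rightarrow> ('a \<Rightarrow> complex) \<Rightarrow> ('a \<Rightarrow> complex) \<Rightarrow> complex" where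
  "L2_inner M f g = (\<integral>x. f x * cnj (g x) \<partial>M)"

definition L2_norm :: "'a measure \<Rightarrow> ('a \<Rightarrow> complex) \<Rightarrow> real" where
  "L2_norm M f = sqrt (\<integral>x. (cmod (f x))\<^sup>2 \<partial>M)"

text \<open>
  Compatibility of \<open>T\<close> with almost-everywhere equality is not listed because it follows: if
  \<open>f = g\<close> a.e., then \<open>T f - T g = T (f - g)\<close> a.e., and this has norm \<open>0\<close>.
\<close>

definition L2_bounded_operator :: "'a measure \<Rightarrow> (('a \<Rightarrow> complex) \<Rightarrow> 'a \<Rightarrow> complex) \<Rightarrow> bool" where
  "L2_bounded_operator M T \<longleftrightarrow>
     (\<forall>f\<in>L2_space M. T f \<in> L2_space M) \<and>
     (\<forall>f\<in>L2_space M. \<forall>g\<in>L2_space M. \<forall>a b.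
        AE x in M. T (\<lambda>y. a * f y + b * g y) x = a * T f x + b * T g x) \<and>
     (\<exists>C. \<forall>f\<in>L2_space M. L2_norm M (T f) \<le> C * L2_norm M f)"

text \<open>
  The Hilbert-space adjoint. For a bounded operator \<open>T\<close> and \<open>g\<close> in \<open>L2_space M\<close>, a function
  \<open>k\<close> as below exists by the Riesz representation theorem and is unique up to null sets.
\<close>

definition L2_adjoint ::
    "'a measure \<Rightarrow> (('a \<Rightarrow> complex) \<Rightarrow> 'a \<Rightarrow> complex) \<Rightarrow> ('a \<Rightarrow> complex) \<Rightarrow> 'a \<Rightarrow> complex" where
  "L2_adjoint M T g =
     (SOME k. k \<in> L2_space M \<and> (\<forall>f\<in>L2_space M. L2_inner M (T f) g = L2_inner M f k))"


section \<open>\<open>m\<close>-isometries and quasi-\<open>m\<close>-isometries\<close>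

definition isometry_defect ::
    "'a measure \<Rightarrow> nat \<Rightarrow> (('a \<Rightarrow> complex) \<Rightarrow> 'a \<Rightarrow> complex) \<Rightarrow> ('a \<Rightarrow> complex) \<Rightarrow> 'a \<Rightarrow> complex" where
  "isometry_defect M m T f =
     (\<lambda>x. \<Sum>k=0..m. (-1) ^ (m - k) * of_nat (m choose k) * (L2_adjoint M T ^^ k) ((T ^^ k) f) x)"

definition m_isometry :: "'a measure \<Rightarrow> nat \<Rightarrow> (('a \<Rightarrow> complex) \<Rightarrow> 'a \<Rightarrow> complex) \<Rightarrow> bool" where
  "m_isometry M m T \<longleftrightarrow>
     L2_bounded_operator M T \<and>
     (\<forall>f\<in>L2_space M. AE x in M. isometry_defect M m T f x = 0)"

definition quasi_m_isometry :: "'a measure \<Rightarrow> nat \<Rightarrow> (('a \<Rightarrow> complex) \<Rightarrow> 'a \<Rightarrow> complex) \<Rightarrow> bool" where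
  "quasi_m_isometry M m T \<longleftrightarrow>
     L2_bounded_operator M T \<and>
     (\<forall>f\<in>L2_space M. AE x in M. L2_adjoint M T (isometry_defect M m T (T f)) x = 0)"


section \<open>Weighted composition operators\<close>

definition nonsingular :: "'a measure \<Rightarrow> ('a \<Rightarrow> 'a) \<Rightarrow> bool" where
  "nonsingular M \<phi> \<longleftrightarrow> \<phi> \<in> measurable M M \<and> absolutely_continuous M (distr M M \<phi>)"

definition weighted_comp_op ::
    "('a \<Rightarrow> complex) \<Rightarrow> ('a \<Rightarrow> 'a) \<Rightarrow> ('a \<Rightarrow> complex) \<Rightarrow> 'a \<Rightarrow> complex" where
  "weighted_comp_op u \<phi> f = (\<lambda>x. u x * f (\<phi> x))"

definition iter_weight :: "('a \<Rightarrow> complex) \<Rightarrow> ('a \<Rightarrow> 'a) \<Rightarrow> nat \<Rightarrow> 'a \<Rightarrow> complex" where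
  "iter_weight u \<phi> n x = (\<Prod>k<n. u ((\<phi> ^^ k) x))"

definition RN_iter :: "'a measure \<Rightarrow> ('a \<Rightarrow> 'a) \<Rightarrow> nat \<Rightarrow> 'a \<Rightarrow> ennreal" where
  "RN_iter M \<phi> n = RN_deriv M (distr M M (\<phi> ^^ n))"

definition preimage_algebra :: "'a measure \<Rightarrow> ('a \<Rightarrow> 'a) \<Rightarrow> nat \<Rightarrow> 'a measure" where
  "preimage_algebra M \<phi> n = vimage_algebra (space M) (\<phi> ^^ n) M"

text \<open>
  \<open>E\<^sub>n(f) \<circ> \<phi>\<^sup>-\<^sup>n\<close>: a measurable \<open>g\<close> with \<open>E\<^sub>n(f) = g \<circ> \<phi>\<^sup>n\<close>. Such a \<open>g\<close> is determined only up to
  null sets of \<open>\<mu> \<circ> \<phi>\<^sup>-\<^sup>n\<close>, so it is the product with \<open>RN_iter M \<phi> n\<close> that is determined a.e.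
\<close>

definition cond_exp_pullback ::
    "'a measure \<Rightarrow> ('a \<Rightarrow> 'a) \<Rightarrow> nat \<Rightarrow> ('a \<Rightarrow> ennreal) \<Rightarrow> 'a \<Rightarrow> ennreal" where
  "cond_exp_pullback M \<phi> n f =
     (SOME g. g \<in> borel_measurable M \<and>
        (AE x in M. nn_cond_exp M (preimage_algebra M \<phi> n) f x = g ((\<phi> ^^ n) x)))"

definition J_fun :: "'a measure \<Rightarrow> ('a \<Rightarrow> 'a) \<Rightarrow> ('a \<Rightarrow> complex) \<Rightarrow> nat \<Rightarrow> 'a \<Rightarrow> ennreal" where
  "J_fun M \<phi> u n x =
     (if n = 0 then 1
      else RN_iter M \<phi> n x *
        cond_exp_pullback M \<phi> n (\<lambda>y. ennreal ((cmod (iter_weight u \<phi> n y))\<^sup>2)) x)"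

text \<open>
  The alternating sums need real values. Nothing is lost by \<open>enn2real\<close> when the weighted
  composition operator \<open>W\<close> is bounded on \<open>L\<^sup>2\<close>, since then \<open>J\<^sub>n\<close> is bounded a.e. by the squared
  operator norm of \<open>W\<^sup>n\<close>.
\<close>

definition G0_fun :: "'a measure \<Rightarrow> ('a \<Rightarrow> 'a) \<Rightarrow> ('a \<Rightarrow> complex) \<Rightarrow> nat \<Rightarrow> 'a \<Rightarrow> real" where
  "G0_fun M \<phi> u m x =
     (\<Sum>k=0..m. (-1) ^ (m - k) * real (m choose k) * enn2real (J_fun M \<phi> u k x))"

definition G_fun :: "'a measure \<Rightarrow> ('a \<Rightarrow> 'a) \<Rightarrow> ('a \<Rightarrow> complex) \<Rightarrow> nat \<Rightarrow> 'a \<Rightarrow> real" where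
  "G_fun M \<phi> u m x =
     (\<Sum>k=0..m. (-1) ^ (m - k) * real (m choose k) * enn2real (J_fun M \<phi> u (k + 1) x))"

end

theory Submission
  imports Defs
begin

text \<open>
  The measure \<open>J\<^sub>n \<mu>\<close> is the push-forward of \<open>|u\<^sub>n|\<^sup>2 \<mu>\<close> under \<open>\<phi>\<^sup>n\<close>. Since
  \<open>u\<^sub>n\<^sub>+\<^sub>1 = u\<^sub>n \<cdot> (u \<circ> \<phi>\<^sup>n)\<close>, the measure \<open>J\<^sub>n\<^sub>+\<^sub>1 \<mu>\<close> is also the push-forward of
  \<open>J\<^sub>n |u|\<^sup>2 \<mu>\<close> under \<open>\<phi>\<close>; this is the recursion for \<open>J\<close>. Read as a change of variables it says
  \<open>\<langle>W f, J\<^sub>n W g\<rangle> = \<langle>f, J\<^sub>n\<^sub>+\<^sub>1 g\<rangle>\<close>, that is \<open>W\<^sup>* J\<^sub>n W = J\<^sub>n\<^sub>+\<^sub>1\<close> as multiplication operators. By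
  induction \<open>W\<^sup>*\<^sup>n W\<^sup>n = J\<^sub>n\<close>, so \<open>B\<^sub>m\<close> and \<open>W\<^sup>* B\<^sub>m W\<close> are the multiplications by \<open>G\<^sup>0\<^sub>m\<close> and
  \<open>G\<^sub>m\<close>. The adjoints are exhibited explicitly, so the Riesz representation theorem is not needed.
\<close>

section \<open>Measure-theoretic preliminaries\<close>

lemma SUP_rat_below_ennreal:
  fixes y :: ennreal
  shows "(SUP q::rat. if ennreal (of_rat q) < y then ennreal (of_rat q) else 0) = y" (is "?S = y")
proof (rule antisym)
  show "?S \<le> y"
    by (rule SUP_least) auto
  show "y \<le> ?S"
  proof (rule dense_le)
    fix z assume "z < y"
    then obtain q :: rat where "z < ennreal (of_rat q)" "ennreal (of_rat q) < y"
      using ennreal_rat_dense by blast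
    then show "z \<le> ?S"
      by (intro SUP_upper2[of q]) auto
  qed
qed

text \<open>Doob-Dynkin factorisation. Each superlevel set of \<open>f\<close> at a rational level
  is the preimage of some measurable set under \<open>\<psi>\<close>, and an \<open>ennreal\<close>
  value is the supremum of the rational levels strictly below it, so these countably many sets
  determine \<open>g\<close>.\<close>

lemma borel_measurable_vimage_algebra_factor:
  fixes f :: "'a \<Rightarrow> ennreal"
  assumes f: "f \<in> borel_measurable (vimage_algebra X \<psi> N)" and \<psi>: "\<psi> \<in> X \<rightarrow> space N"
  obtains g where "g \<in> borel_measurable N" "\<And>x. x \<in> X \<Longrightarrow> f x = g (\<psi> x)"
proof -
  have "\<exists>A\<in>sets N. {x \<in> X. ennreal (of_rat q) < f x} = \<psi> -` A \<inter> X" for q :: rat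
  proof -
    have "{x \<in> space (vimage_algebra X \<psi> N). ennreal (of_rat q) < f x} \<in> sets (vimage_algebra X \<psi> N)"
      using f by measurable
    then show ?thesis
      using sets_vimage_algebra2[OF \<psi>] by auto
  qed
  then obtain A where A: "\<And>q::rat. A q \<in> sets N"
      "\<And>q. {x \<in> X. ennreal (of_rat q) < f x} = \<psi> -` A q \<inter> X"
    by metis
  \<comment> \<open>Off the image of \<open>\<psi>\<close> the sets \<open>A q\<close> need not be
    nested. The supremum still defines a measurable function there, and its values at such points do
    not matter.\<close>
  define g where "g = (\<lambda>y. SUP q::rat. if y \<in> A q then ennreal (of_rat q) else 0)"
  show ?thesis
  proof
    show "g \<in> borel_measurable N"
      unfolding g_def using A(1) by measurable
    fix x assume "x \<in> X"
    then have "\<psi> x \<in> A q \<longleftrightarrow> ennreal (of_rat q) < f x" for q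
      using A(2)[of q] by blast
    then show "f x = g (\<psi> x)"
      unfolding g_def by (simp only: SUP_rat_below_ennreal)
  qed
qed

lemma (in sigma_finite_measure) AE_le_const_of_density_le:
  fixes c :: ennreal
  assumes [measurable]: "f \<in> borel_measurable M"
    and le: "\<And>A. A \<in> sets M \<Longrightarrow> emeasure (density M f) A \<le> c * emeasure M A"
  shows "AE x in M. f x \<le> c"
proof -
  \<comment> \<open>Comparing with \<open>max f c\<close> reduces the inequality to the uniqueness of densities.\<close>
  have "density M (\<lambda>x. max (f x) c) = density M (\<lambda>_. c)"
  proof (rule measure_eqI)
    fix A assume "A \<in> sets (density M (\<lambda>x. max (f x) c))"
    then have A[measurable]: "A \<in> sets M" by simp
    define B where "B = {x \<in> space M. c < f x}"
    have B[measurable]: "B \<in> sets M" unfolding B_def by measurable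
    have "emeasure (density M (\<lambda>x. max (f x) c)) A
        = (\<integral>\<^sup>+x. f x * indicator (A \<inter> B) x + c * indicator (A - B) x \<partial>M)"
      by (auto simp: emeasure_density B_def max_def split: split_indicator
          intro!: nn_integral_cong)
    also have "\<dots> = emeasure (density M f) (A \<inter> B) + c * emeasure M (A - B)"
      by (simp add: nn_integral_add emeasure_density nn_integral_cmult_indicator)
    \<comment> \<open>The hypothesis is applied only to \<open>A \<inter> B\<close>, the part of
      \<open>A\<close> where \<open>f\<close> exceeds \<open>c\<close>; on the rest the density is
      already \<open>c\<close>.\<close>
    also have "\<dots> \<le> c * emeasure M (A \<inter> B) + c * emeasure M (A - B)"
      by (intro add_right_mono le) simp
    also have "\<dots> = c * emeasure M A"
      using plus_emeasure[of "A \<inter> B" M "A - B"] by (simp add: Int_Diff_Un Int_Diff_disjoint flip: distrib_left)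
    finally have "emeasure (density M (\<lambda>x. max (f x) c)) A \<le> c * emeasure M A" .
    moreover have "(\<integral>\<^sup>+x. c * indicator A x \<partial>M) \<le> emeasure (density M (\<lambda>x. max (f x) c)) A"
      unfolding emeasure_density[OF _ A] by (subst emeasure_density) (auto intro!: nn_integral_mono mult_right_mono)
    ultimately show "emeasure (density M (\<lambda>x. max (f x) c)) A = emeasure (density M (\<lambda>_. c)) A"
      by (auto simp: emeasure_density nn_integral_cmult_indicator)
  qed simp
  then have "AE x in M. max (f x) c = c"
    by (intro density_unique) auto
  then show ?thesis
    by eventually_elim (simp add: max_def split: if_splits)
qed


section \<open>The space of square-integrable functions\<close>

lemma borel_measurable_cnj [measurable (raw)]:
  "f \<in> borel_measurable M \<Longrightarrow> (\<lambda>x. cnj (f x)) \<in> borel_measurable M"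
  by (rule borel_measurable_continuous_on[OF continuous_on_cnj[OF continuous_on_id]])

lemma L2_space_measurable: "f \<in> L2_space M \<Longrightarrow> f \<in> borel_measurable M"
  by (simp add: L2_space_def)

lemma L2_space_zero: "(\<lambda>_. 0) \<in> L2_space M"
  by (simp add: L2_space_def)

lemma L2_space_add:
  assumes "f \<in> L2_space M" "g \<in> L2_space M"
  shows "(\<lambda>x. f x + g x) \<in> L2_space M"
proof -
  have [measurable]: "f \<in> borel_measurable M" "g \<in> borel_measurable M"
    using assms by (auto simp: L2_space_def)
  have "integrable M (\<lambda>x. 2 * (cmod (f x))\<^sup>2 + 2 * (cmod (g x))\<^sup>2)"
    using assms by (auto simp: L2_space_def)
  then have "integrable M (\<lambda>x. (cmod (f x + g x))\<^sup>2)"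
  proof (rule Bochner_Integration.integrable_bound)
    have "(cmod (a + b))\<^sup>2 \<le> 2 * (cmod a)\<^sup>2 + 2 * (cmod b)\<^sup>2" for a b :: complex
    proof -
      have "(cmod (a + b))\<^sup>2 \<le> (cmod a + cmod b)\<^sup>2"
        by (intro power_mono norm_triangle_ineq) auto
      also have "\<dots> \<le> 2 * (cmod a)\<^sup>2 + 2 * (cmod b)\<^sup>2"
        using zero_le_power2[of "cmod a - cmod b"] by (simp add: power2_eq_square algebra_simps)
      finally show ?thesis .
    qed
    then show "AE x in M. norm ((cmod (f x + g x))\<^sup>2) \<le> norm (2 * (cmod (f x))\<^sup>2 + 2 * (cmod (g x))\<^sup>2)"
      by auto
  qed measurable
  then show ?thesis
    by (simp add: L2_space_def)
qed

lemma L2_space_mult_bounded: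
  assumes "f \<in> L2_space M" and p[measurable]: "p \<in> borel_measurable M"
    and bd: "AE x in M. cmod (p x) \<le> K"
  shows "(\<lambda>x. p x * f x) \<in> L2_space M"
proof -
  have [measurable]: "f \<in> borel_measurable M"
    using assms by (auto simp: L2_space_def)
  have "integrable M (\<lambda>x. K\<^sup>2 * (cmod (f x))\<^sup>2)"
    using assms by (auto simp: L2_space_def)
  then have "integrable M (\<lambda>x. (cmod (p x * f x))\<^sup>2)"
  proof (rule Bochner_Integration.integrable_bound)
    show "AE x in M. norm ((cmod (p x * f x))\<^sup>2) \<le> norm (K\<^sup>2 * (cmod (f x))\<^sup>2)"
      using bd by eventually_elim
        (auto simp: norm_mult power_mult_distrib intro!: mult_right_mono power_mono)
  qed measurable
  then show ?thesis
    by (simp add: L2_space_def)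
qed

lemma L2_space_cmult: "f \<in> L2_space M \<Longrightarrow> (\<lambda>x. c * f x) \<in> L2_space M"
  by (rule L2_space_mult_bounded[where K = "cmod c"]) auto

lemma L2_space_sum:
  assumes "\<And>i. i \<in> I \<Longrightarrow> F i \<in> L2_space M"
  shows "(\<lambda>x. \<Sum>i\<in>I. F i x) \<in> L2_space M"
  using assms by (induction I rule: infinite_finite_induct) (auto simp: L2_space_zero L2_space_add)

lemma L2_inner_integrable:
  assumes "f \<in> L2_space M" "g \<in> L2_space M"
  shows "integrable M (\<lambda>x. f x * cnj (g x))"
proof -
  have [measurable]: "f \<in> borel_measurable M" "g \<in> borel_measurable M"
    using assms by (auto simp: L2_space_def)
  have "integrable M (\<lambda>x. (cmod (f x))\<^sup>2 + (cmod (g x))\<^sup>2)"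
    using assms by (auto simp: L2_space_def)
  then show ?thesis
  proof (rule Bochner_Integration.integrable_bound)
    have "cmod a * cmod b \<le> (cmod a)\<^sup>2 + (cmod b)\<^sup>2" for a b
      using sum_squares_bound[of "cmod a" "cmod b"]
        mult_nonneg_nonneg[OF norm_ge_zero[of a] norm_ge_zero[of b]]
      by linarith
    then show "AE x in M. norm (f x * cnj (g x)) \<le> norm ((cmod (f x))\<^sup>2 + (cmod (g x))\<^sup>2)"
      by (auto simp: norm_mult)
  qed measurable
qed

lemma L2_inner_add_right:
  assumes "f \<in> L2_space M" "g \<in> L2_space M" "h \<in> L2_space M"
  shows "L2_inner M f (\<lambda>x. g x + h x) = L2_inner M f g + L2_inner M f h"
  using assms by (simp add: L2_inner_def distrib_left L2_inner_integrable)

lemma L2_inner_cmult_right: "L2_inner M f (\<lambda>x. c * g x) = cnj c * L2_inner M f g"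
  unfolding L2_inner_def by (simp add: mult.left_commute)

lemma L2_inner_sum_right:
  assumes "f \<in> L2_space M" "\<And>i. i \<in> I \<Longrightarrow> F i \<in> L2_space M"
  shows "L2_inner M f (\<lambda>x. \<Sum>i\<in>I. F i x) = (\<Sum>i\<in>I. L2_inner M f (F i))"
  using assms
  by (induction I rule: infinite_finite_induct)
     (auto simp: L2_inner_add_right L2_space_sum L2_inner_def[of _ _ "\<lambda>_. 0"])

lemma L2_inner_cong_right:
  assumes [measurable]: "f \<in> borel_measurable M" "g \<in> borel_measurable M" "h \<in> borel_measurable M"
    and eq: "AE x in M. g x = h x"
  shows "L2_inner M f g = L2_inner M f h"
  unfolding L2_inner_def
proof (rule integral_cong_AE)
  show "AE x in M. f x * cnj (g x) = f x * cnj (h x)"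
    using eq by eventually_elim simp
qed measurable

lemma L2_inner_eq_imp_AE_eq:
  assumes k: "k \<in> L2_space M" and l: "l \<in> L2_space M"
    and eq: "\<And>f. f \<in> L2_space M \<Longrightarrow> L2_inner M f k = L2_inner M f l"
  shows "AE x in M. k x = l x"
proof -
  \<comment> \<open>The difference itself serves as the test function. It is written as a sum with
    the factor -1 so that the rules for sums and scalar multiples apply directly.\<close>
  define d where "d = (\<lambda>x. k x + (-1) * l x)"
  have d: "d \<in> L2_space M"
    unfolding d_def by (intro L2_space_add L2_space_cmult k l)
  have "L2_inner M d d = 0"
    using L2_inner_add_right[OF d k L2_space_cmult[OF l, of "-1"]] eq[OF d]
    unfolding L2_inner_cmult_right d_def[symmetric] by simp
  moreover have "L2_inner M d d = of_real (\<integral>x. (cmod (d x))\<^sup>2 \<partial>M)"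
    unfolding L2_inner_def by (simp add: complex_norm_square[symmetric] del: of_real_power)
  ultimately have "(\<integral>x. (cmod (d x))\<^sup>2 \<partial>M) = 0"
    by simp
  then have "AE x in M. (cmod (d x))\<^sup>2 = 0"
    using d by (subst (asm) integral_nonneg_eq_0_iff_AE) (auto simp: L2_space_def)
  then show ?thesis
    by eventually_elim (simp add: d_def)
qed

text \<open>As \<open>L2_adjoint\<close> is a Hilbert choice, exhibiting one representative
  \<open>k\<close> ensures that the chosen function has the defining property. Testing against all
  of \<open>L2_space M\<close> then identifies the two a.e.\<close>

lemma
  assumes k: "k \<in> L2_space M"
    and adj: "\<And>f. f \<in> L2_space M \<Longrightarrow> L2_inner M (T f) g = L2_inner M f k"
  shows L2_adjoint_AE_eq: "AE x in M. L2_adjoint M T g x = k x"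
    and L2_adjoint_in_L2_space: "L2_adjoint M T g \<in> L2_space M"
proof -
  have *: "L2_adjoint M T g \<in> L2_space M \<and>
      (\<forall>f\<in>L2_space M. L2_inner M (T f) g = L2_inner M f (L2_adjoint M T g))"
    unfolding L2_adjoint_def by (rule someI[of _ k]) (use assms in auto)
  then show "L2_adjoint M T g \<in> L2_space M" by simp
  show "AE x in M. L2_adjoint M T g x = k x"
    using * assms by (intro L2_inner_eq_imp_AE_eq) auto
qed

text \<open>The choice depends on \<open>g\<close> only through the numbers
  \<open>L2_inner M (T f) g\<close>. Functions equal a.e. thus give the same predicate and so
  literally the same chosen function, whether or not a representative exists.\<close>

lemma L2_adjoint_cong:
  assumes "\<And>f. f \<in> L2_space M \<Longrightarrow> T f \<in> borel_measurable M"
    and "g \<in> borel_measurable M" "h \<in> borel_measurable M" "AE x in M. g x = h x"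
  shows "L2_adjoint M T g = L2_adjoint M T h"
proof -
  have "L2_inner M (T f) g = L2_inner M (T f) h" if "f \<in> L2_space M" for f
    by (intro L2_inner_cong_right assms that)
  then show ?thesis
    unfolding L2_adjoint_def by (simp cong: conj_cong ball_cong)
qed

text \<open>Sigma-finiteness supplies a strictly positive integrable \<open>w\<close>. Its square
  root is a square-integrable function without zeros, and this one test function already forces
  \<open>q\<close> to vanish a.e.\<close>

lemma (in sigma_finite_measure) AE_eq_0_iff_L2_mult:
  fixes q :: "'a \<Rightarrow> real"
  shows "(\<forall>f\<in>L2_space M. AE x in M. of_real (q x) * f x = 0) \<longleftrightarrow> (AE x in M. q x = 0)"
proof
  assume L: "\<forall>f\<in>L2_space M. AE x in M. of_real (q x) * f x = 0"
  obtain w :: "'a \<Rightarrow> real" where w: "w \<in> borel_measurable M" "\<And>x. 0 < w x" "integrable M w"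
    by (rule obtain_positive_integrable_function) (rule that)
  have "(cmod (complex_of_real (sqrt (w x))))\<^sup>2 = w x" for x
    using w(2)[of x] by simp
  then have "(\<lambda>x. complex_of_real (sqrt (w x))) \<in> L2_space M"
    using w(1,3) by (simp add: L2_space_def)
  from bspec[OF L this] show "AE x in M. q x = 0"
  proof eventually_elim
    case (elim x)
    then show ?case
      using w(2)[of x] by simp
  qed
next
  assume q: "AE x in M. q x = 0"
  have "AE x in M. of_real (q x) * f x = 0" for f :: "'a \<Rightarrow> complex"
    using q by eventually_elim simp
  then show "\<forall>f\<in>L2_space M. AE x in M. of_real (q x) * f x = 0"
    by blast
qed


section \<open>Weighted composition operators\<close>

locale bounded_weighted_comp_op = sigma_finite_measure M
  for M :: "'a measure" and \<phi> :: "'a \<Rightarrow> 'a" and u :: "'a \<Rightarrow> complex" +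
  assumes nonsingular: "nonsingular M \<phi>"
    and subalgebra: "n \<ge> 1 \<Longrightarrow> sigma_finite_subalgebra M (preimage_algebra M \<phi> n)"
    and u_measurable [measurable]: "u \<in> borel_measurable M"
    and bounded: "L2_bounded_operator M (weighted_comp_op u \<phi>)"
begin

abbreviation W :: "('a \<Rightarrow> complex) \<Rightarrow> 'a \<Rightarrow> complex" where
  "W \<equiv> weighted_comp_op u \<phi>"

abbreviation J :: "nat \<Rightarrow> 'a \<Rightarrow> ennreal" where
  "J \<equiv> J_fun M \<phi> u"

section \<open>Iterates of \<phi>, their Radon-Nikodym derivatives and conditional
  expectations\<close>

lemma phi_measurable [measurable]: "\<phi> \<in> measurable M M"
  using nonsingular by (simp add: nonsingular_def)

lemma phi_funpow_measurable [measurable]: "\<phi> ^^ n \<in> measurable M M"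
  by (induction n) (auto simp: id_def intro: measurable_comp)

lemma absolutely_continuous_distr_funpow: "absolutely_continuous M (distr M M (\<phi> ^^ n))"
proof (induction n)
  case 0
  then show ?case
    by (simp add: absolutely_continuous_def id_def)
next
  case (Suc n)
  show ?case
    unfolding absolutely_continuous_def
  proof
    fix N assume N: "N \<in> null_sets M"
    then have N_sets[measurable]: "N \<in> sets M" by auto
    have "N \<in> null_sets (distr M M \<phi>)"
      using nonsingular N by (auto simp: nonsingular_def absolutely_continuous_def)
    then have "\<phi> -` N \<inter> space M \<in> null_sets M"
      by (simp add: null_sets_distr_iff)
    then have "\<phi> -` N \<inter> space M \<in> null_sets (distr M M (\<phi> ^^ n))"
      using Suc.IH by (auto simp: absolutely_continuous_def)
    then have "(\<phi> ^^ n) -` (\<phi> -` N \<inter> space M) \<inter> space M \<in> null_sets M"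
      by (simp add: null_sets_distr_iff)
    also have "(\<phi> ^^ n) -` (\<phi> -` N \<inter> space M) \<inter> space M = (\<phi> ^^ Suc n) -` N \<inter> space M"
      using measurable_space[OF phi_funpow_measurable] by auto
    finally show "N \<in> null_sets (distr M M (\<phi> ^^ Suc n))"
      using phi_funpow_measurable[of "Suc n"] by (simp add: null_sets_distr_iff del: funpow.simps)
  qed
qed

lemma density_RN_iter: "density M (RN_iter M \<phi> n) = distr M M (\<phi> ^^ n)"
  unfolding RN_iter_def by (rule density_RN_deriv) (simp_all add: absolutely_continuous_distr_funpow)

lemma RN_iter_measurable [measurable]: "RN_iter M \<phi> n \<in> borel_measurable M"
  unfolding RN_iter_def by simp

text \<open>A conditional expectation is measurable for the preimage algebra, so it factors through
  \<open>\<phi> ^^ n\<close>. The factor is a witness for the choice in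
  \<open>cond_exp_pullback\<close>, which therefore has its specified properties.\<close>

lemma
  shows cond_exp_pullback_measurable [measurable]: "cond_exp_pullback M \<phi> n f \<in> borel_measurable M"
    and AE_cond_exp_pullback:
      "AE x in M. nn_cond_exp M (preimage_algebra M \<phi> n) f x = cond_exp_pullback M \<phi> n f ((\<phi> ^^ n) x)"
proof -
  have "\<phi> ^^ n \<in> space M \<rightarrow> space M"
    using measurable_space[OF phi_funpow_measurable] by auto
  from borel_measurable_vimage_algebra_factor
    [OF borel_measurable_nn_cond_exp[of M "preimage_algebra M \<phi> n" f, unfolded preimage_algebra_def] this]
  obtain g where "g \<in> borel_measurable M"
      "\<And>x. x \<in> space M \<Longrightarrow> nn_cond_exp M (preimage_algebra M \<phi> n) f x = g ((\<phi> ^^ n) x)"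
    unfolding preimage_algebra_def by blast
  then have "\<exists>g. g \<in> borel_measurable M \<and>
      (AE x in M. nn_cond_exp M (preimage_algebra M \<phi> n) f x = g ((\<phi> ^^ n) x))"
    by (auto intro!: AE_I2)
  from someI_ex[OF this, folded cond_exp_pullback_def]
  show "cond_exp_pullback M \<phi> n f \<in> borel_measurable M"
    and "AE x in M. nn_cond_exp M (preimage_algebra M \<phi> n) f x = cond_exp_pullback M \<phi> n f ((\<phi> ^^ n) x)"
    by auto
qed

text \<open>The source of both formulas for \<open>J\<close>: the weight \<open>f\<close> = |u_n|^2
  gives the definition, and \<open>f\<close> = J_n |u|^2 with exponent 1 gives the recursion.
  Multiplying by \<open>RN_iter\<close> removes the ambiguity of the pullback, since integration
  then takes place against the push-forward of \<mu>.\<close>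

lemma density_RN_iter_cond_exp_pullback:
  assumes [measurable]: "f \<in> borel_measurable M" and n: "n \<ge> 1"
  shows "density M (\<lambda>x. RN_iter M \<phi> n x * cond_exp_pullback M \<phi> n f x) = distr (density M f) M (\<phi> ^^ n)"
proof (rule measure_eqI)
  interpret sub: sigma_finite_subalgebra M "preimage_algebra M \<phi> n"
    by (rule subalgebra[OF n])
  let ?g = "cond_exp_pullback M \<phi> n f"
  fix A assume "A \<in> sets (density M (\<lambda>x. RN_iter M \<phi> n x * ?g x))"
  then have A[measurable]: "A \<in> sets M" by simp
  \<comment> \<open>A set of this form lies in the preimage algebra, which is what allows the
    conditional expectation of \<open>f\<close> to be replaced by \<open>f\<close> under the
    integral over it.\<close>
  define B where "B = (\<phi> ^^ n) -` A \<inter> space M"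
  have B_ind: "indicator B x = (indicator A ((\<phi> ^^ n) x) :: ennreal)" if "x \<in> space M" for x
    using that by (simp add: B_def indicator_def)
  have B: "B \<in> sets (preimage_algebra M \<phi> n)"
    unfolding B_def preimage_algebra_def by (rule in_vimage_algebra[OF A])
  have [measurable]: "B \<in> sets M"
    unfolding B_def by measurable
  have "emeasure (density M (\<lambda>x. RN_iter M \<phi> n x * ?g x)) A
      = (\<integral>\<^sup>+x. RN_iter M \<phi> n x * (?g x * indicator A x) \<partial>M)"
    by (simp add: emeasure_density mult.assoc)
  also have "\<dots> = (\<integral>\<^sup>+x. ?g x * indicator A x \<partial>distr M M (\<phi> ^^ n))"
    by (simp add: nn_integral_density flip: density_RN_iter)
  also have "\<dots> = (\<integral>\<^sup>+x. ?g ((\<phi> ^^ n) x) * indicator A ((\<phi> ^^ n) x) \<partial>M)"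
    by (simp add: nn_integral_distr)
  also have "\<dots> = (\<integral>\<^sup>+x. indicator B x * nn_cond_exp M (preimage_algebra M \<phi> n) f x \<partial>M)"
  proof (rule nn_integral_cong_AE)
    show "AE x in M. ?g ((\<phi> ^^ n) x) * indicator A ((\<phi> ^^ n) x)
        = indicator B x * nn_cond_exp M (preimage_algebra M \<phi> n) f x"
      using AE_cond_exp_pullback[of n f] AE_space
      by eventually_elim (simp add: B_ind mult.commute)
  qed
  also have "\<dots> = (\<integral>\<^sup>+x. indicator B x * f x \<partial>M)"
    using B by (intro sub.nn_cond_exp_intg) auto
  also have "\<dots> = emeasure (distr (density M f) M (\<phi> ^^ n)) A"
    by (simp add: emeasure_distr emeasure_density B_def mult.commute)
  finally show "emeasure (density M (\<lambda>x. RN_iter M \<phi> n x * ?g x)) A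
      = emeasure (distr (density M f) M (\<phi> ^^ n)) A" .
qed simp

section \<open>The functions J_n as densities, and their recursion\<close>

lemma iter_weight_measurable [measurable]: "iter_weight u \<phi> n \<in> borel_measurable M"
  unfolding iter_weight_def[abs_def] by measurable

lemma J_measurable [measurable]: "J n \<in> borel_measurable M"
  unfolding J_fun_def[abs_def] by measurable

lemma density_J: "density M (J n) = distr (density M (\<lambda>x. ennreal ((cmod (iter_weight u \<phi> n x))\<^sup>2))) M (\<phi> ^^ n)"
proof (cases "n = 0")
  \<comment> \<open>The value 1 prescribed for \<open>J 0\<close> agrees with the empty product
    \<open>iter_weight u \<phi> 0\<close> and the identity map \<open>\<phi> ^^ 0\<close>.\<close>
  case True
  then show ?thesis
    by (simp add: J_fun_def[abs_def] iter_weight_def id_def density_1 distr_id2)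
next
  case False
  then have "J n = (\<lambda>x. RN_iter M \<phi> n x *
      cond_exp_pullback M \<phi> n (\<lambda>y. ennreal ((cmod (iter_weight u \<phi> n y))\<^sup>2)) x)"
    by (simp add: J_fun_def fun_eq_iff)
  then show ?thesis
    using False by (simp add: density_RN_iter_cond_exp_pullback)
qed

lemma density_J_Suc:
  "density M (J (Suc n)) = distr (density M (\<lambda>x. J n x * ennreal ((cmod (u x))\<^sup>2))) M \<phi>"
proof (rule measure_eqI)
  fix A assume "A \<in> sets (density M (J (Suc n)))"
  then have [measurable]: "A \<in> sets M" by simp
  let ?w = "\<lambda>n x. ennreal ((cmod (iter_weight u \<phi> n x))\<^sup>2)"
  let ?v = "\<lambda>x. ennreal ((cmod (u x))\<^sup>2) * indicator A (\<phi> x)"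
  have "emeasure (density M (J (Suc n))) A = (\<integral>\<^sup>+x. indicator A x \<partial>density M (J (Suc n)))"
    by simp
  also have "\<dots> = (\<integral>\<^sup>+x. ?w (Suc n) x * indicator A ((\<phi> ^^ Suc n) x) \<partial>M)"
    unfolding density_J by (simp add: nn_integral_distr nn_integral_density del: funpow.simps nn_integral_indicator)
  \<comment> \<open>The last factor of \<open>iter_weight\<close> and the indicator both depend on
    \<open>x\<close> only through \<open>(\<phi> ^^ n) x\<close>. Pushing forward by
    \<open>\<phi> ^^ n\<close> therefore turns the remaining weight |u_n|^2 into J_n.\<close>
  also have "\<dots> = (\<integral>\<^sup>+x. ?w n x * ?v ((\<phi> ^^ n) x) \<partial>M)"
    by (simp add: iter_weight_def norm_mult power_mult_distrib ennreal_mult mult.assoc)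
  also have "\<dots> = (\<integral>\<^sup>+x. ?v x \<partial>density M (J n))"
    unfolding density_J by (simp add: nn_integral_distr nn_integral_density)
  also have "\<dots> = (\<integral>\<^sup>+x. J n x * ?v x \<partial>M)"
    by (simp add: nn_integral_density)
  also have "\<dots> = (\<integral>\<^sup>+x. indicator A x \<partial>distr (density M (\<lambda>x. J n x * ennreal ((cmod (u x))\<^sup>2))) M \<phi>)"
    by (simp add: nn_integral_distr nn_integral_density mult.assoc del: nn_integral_indicator)
  also have "\<dots> = emeasure (distr (density M (\<lambda>x. J n x * ennreal ((cmod (u x))\<^sup>2))) M \<phi>) A"
    by simp
  finally show "emeasure (density M (J (Suc n))) A
      = emeasure (distr (density M (\<lambda>x. J n x * ennreal ((cmod (u x))\<^sup>2))) M \<phi>) A" .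
qed simp

text \<open>Both sides are densities of the same push-forward under \<open>\<phi>\<close>, and
  densities with respect to a sigma-finite measure are unique a.e.\<close>

lemma AE_J_Suc:
  "AE x in M. J (Suc n) x =
     RN_iter M \<phi> 1 x * cond_exp_pullback M \<phi> 1 (\<lambda>y. J n y * ennreal ((cmod (u y))\<^sup>2)) x"
  by (rule density_unique) (simp_all add: density_RN_iter_cond_exp_pullback density_J_Suc)

section \<open>Essential boundedness of J_n\<close>

lemma W_L2: "f \<in> L2_space M \<Longrightarrow> W f \<in> L2_space M"
  using bounded by (simp add: L2_bounded_operator_def)

text \<open>For \<open>A\<close> of finite measure the indicator of \<open>A\<close> is
  square-integrable, and the squared norm of its image under \<open>W\<close> is the mass of
  \<open>A\<close> under the measure with density \<open>J 1\<close>. The operator bound thus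
  compares this measure with \<mu>.\<close>

lemma ex_AE_J_one_le: "\<exists>K::real. K \<ge> 0 \<and> (AE x in M. J 1 x \<le> ennreal K)"
proof -
  obtain C where C: "\<And>f. f \<in> L2_space M \<Longrightarrow> L2_norm M (W f) \<le> C * L2_norm M f"
    using bounded unfolding L2_bounded_operator_def by blast
  \<comment> \<open>The summand 1 makes \<open>K\<close> strictly positive, so that the bound is
    infinite on sets of infinite measure even when \<open>C\<close> is 0.\<close>
  define K where "K = 1 + C\<^sup>2"
  have K: "K > 0" by (simp add: K_def add_pos_nonneg)
  have "AE x in M. J 1 x \<le> ennreal K"
  proof (rule AE_le_const_of_density_le)
    fix A assume A[measurable]: "A \<in> sets M"
    show "emeasure (density M (J 1)) A \<le> ennreal K * emeasure M A"
    proof (cases "emeasure M A = \<infinity>")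
      case True
      then show ?thesis
        using K by (simp add: ennreal_mult_top)
    next
      case False
      let ?f = "\<lambda>x. complex_of_real (indicator A x)"
      have ind2: "(cmod (?f x))\<^sup>2 = indicator A x" for x
        by (simp add: indicator_def)
      have f: "?f \<in> L2_space M"
        using False unfolding L2_space_def mem_Collect_eq ind2 by (auto simp: less_top)
      have "emeasure (density M (J 1)) A = (\<integral>\<^sup>+x. indicator A x \<partial>density M (J 1))"
        by simp
      also have "\<dots> = (\<integral>\<^sup>+x. ennreal ((cmod (u x))\<^sup>2) * indicator A (\<phi> x) \<partial>M)"
        unfolding density_J
        by (simp add: nn_integral_distr nn_integral_density iter_weight_def del: nn_integral_indicator)
      also have "\<dots> = (\<integral>\<^sup>+x. ennreal ((cmod (W ?f x))\<^sup>2) \<partial>M)"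
        unfolding weighted_comp_op_def norm_mult power_mult_distrib ind2
        by (simp add: ennreal_mult ennreal_indicator)
      also have "\<dots> = ennreal (\<integral>x. (cmod (W ?f x))\<^sup>2 \<partial>M)"
        using W_L2[OF f] by (intro nn_integral_eq_integral) (auto simp: L2_space_def)
      also have "\<dots> = ennreal ((L2_norm M (W ?f))\<^sup>2)"
        by (simp add: L2_norm_def)
      also have "\<dots> \<le> ennreal ((C * L2_norm M ?f)\<^sup>2)"
        using C[OF f] by (intro ennreal_leI power_mono) (auto simp: L2_norm_def)
      also have "\<dots> = ennreal (C\<^sup>2 * measure M A)"
        unfolding power_mult_distrib L2_norm_def ind2 by simp
      also have "\<dots> \<le> ennreal (K * measure M A)"
        by (intro ennreal_leI mult_right_mono) (auto simp: K_def)
      also have "\<dots> = ennreal K * emeasure M A"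
        using False K by (simp add: ennreal_mult emeasure_eq_ennreal_measure)
      finally show ?thesis .
    qed
  qed measurable
  then show ?thesis
    using K by (intro exI[of _ K]) simp
qed

text \<open>By the recursion, a bound \<open>K\<close> for J_n makes the measure with density
  J_(n+1) at most \<open>K\<close> times the one with density J_1. Each step therefore costs one
  factor \<open>L\<close>.\<close>

lemma ex_AE_J_le: "\<exists>K::real. K \<ge> 0 \<and> (AE x in M. J n x \<le> ennreal K)"
proof (induction n)
  case 0
  then show ?case
    by (intro exI[of _ 1]) (simp add: J_fun_def)
next
  case (Suc n)
  then obtain K :: real where K: "K \<ge> 0" "AE x in M. J n x \<le> ennreal K" by blast
  obtain L :: real where L: "L \<ge> 0" "AE x in M. J 1 x \<le> ennreal L"
    using ex_AE_J_one_le by blast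
  have "AE x in M. J (Suc n) x \<le> ennreal (K * L)"
  proof (rule AE_le_const_of_density_le)
    fix A assume [measurable]: "A \<in> sets M"
    let ?v = "\<lambda>x. ennreal ((cmod (u x))\<^sup>2) * indicator A (\<phi> x)"
    have J1: "emeasure (density M (J 1)) A = (\<integral>\<^sup>+x. ?v x \<partial>M)"
    proof -
      have "emeasure (density M (J 1)) A = (\<integral>\<^sup>+x. indicator A x \<partial>density M (J 1))"
        by simp
      then show ?thesis
        unfolding density_J
        by (simp add: nn_integral_distr nn_integral_density iter_weight_def del: nn_integral_indicator)
    qed
    have "emeasure (density M (J (Suc n))) A = (\<integral>\<^sup>+x. indicator A x \<partial>density M (J (Suc n)))"
      by simp
    also have "\<dots> = (\<integral>\<^sup>+x. J n x * ?v x \<partial>M)"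
      unfolding density_J_Suc
      by (simp add: nn_integral_distr nn_integral_density mult.assoc del: nn_integral_indicator)
    also have "\<dots> \<le> (\<integral>\<^sup>+x. ennreal K * ?v x \<partial>M)"
    proof (rule nn_integral_mono_AE)
      show "AE x in M. J n x * ?v x \<le> ennreal K * ?v x"
        using K(2) by eventually_elim (rule mult_right_mono, auto)
    qed
    also have "\<dots> = ennreal K * emeasure (density M (J 1)) A"
      unfolding J1 by (rule nn_integral_cmult) measurable
    also have "\<dots> \<le> ennreal K * (\<integral>\<^sup>+x. ennreal L * indicator A x \<partial>M)"
    proof (rule mult_left_mono)
      show "emeasure (density M (J 1)) A \<le> (\<integral>\<^sup>+x. ennreal L * indicator A x \<partial>M)"
        unfolding emeasure_density[OF J_measurable \<open>A \<in> sets M\<close>]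
      proof (rule nn_integral_mono_AE)
        show "AE x in M. J 1 x * indicator A x \<le> ennreal L * indicator A x"
          using L(2) by eventually_elim (rule mult_right_mono, auto)
      qed
    qed simp
    also have "\<dots> = ennreal (K * L) * emeasure M A"
      using K(1) L(1) by (simp add: nn_integral_cmult_indicator ennreal_mult mult.assoc)
    finally show "emeasure (density M (J (Suc n))) A \<le> ennreal (K * L) * emeasure M A" .
  qed measurable
  then show ?case
    using K(1) L(1) by (intro exI[of _ "K * L"]) simp
qed

section \<open>The real-valued multipliers and the change of variables for \<open>W\<close>\<close>

definition Jr :: "nat \<Rightarrow> 'a \<Rightarrow> real" where
  "Jr n x = enn2real (J n x)"

lemma Jr_measurable [measurable]: "Jr n \<in> borel_measurable M"
  unfolding Jr_def[abs_def] by measurable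

lemma Jr_nonneg [simp]: "0 \<le> Jr n x"
  by (simp add: Jr_def)

text \<open>The essential bound confines the value \<infinity>, which \<open>enn2real\<close> would
  send to 0, to a null set.\<close>

lemma AE_ennreal_Jr: "AE x in M. ennreal (Jr n x) = J n x"
proof -
  obtain K :: real where "AE x in M. J n x \<le> ennreal K"
    using ex_AE_J_le by blast
  then show ?thesis
    by eventually_elim (auto simp: Jr_def ennreal_enn2real_if top_unique)
qed

lemma Jr_mult_L2:
  assumes "f \<in> L2_space M"
  shows "(\<lambda>x. of_real (Jr n x) * f x) \<in> L2_space M"
proof -
  obtain K :: real where K: "K \<ge> 0" "AE x in M. J n x \<le> ennreal K"
    using ex_AE_J_le by blast
  have "AE x in M. cmod (of_real (Jr n x)) \<le> K"
    using K(2) by eventually_elim (use K(1) in \<open>simp add: Jr_def enn2real_leI\<close>)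
  then show ?thesis
    by (intro L2_space_mult_bounded[OF assms]) auto
qed

lemma density_Jr_Suc:
  "density M (\<lambda>x. ennreal (Jr (Suc n) x)) = distr (density M (\<lambda>x. ennreal (Jr n x * (cmod (u x))\<^sup>2))) M \<phi>"
proof -
  have "density M (\<lambda>x. ennreal (Jr (Suc n) x)) = density M (J (Suc n))"
    by (rule density_cong) (use AE_ennreal_Jr in auto)
  also have "\<dots> = distr (density M (\<lambda>x. J n x * ennreal ((cmod (u x))\<^sup>2))) M \<phi>"
    by (rule density_J_Suc)
  also have "density M (\<lambda>x. J n x * ennreal ((cmod (u x))\<^sup>2)) = density M (\<lambda>x. ennreal (Jr n x * (cmod (u x))\<^sup>2))"
  proof (rule density_cong)
    show "AE x in M. J n x * ennreal ((cmod (u x))\<^sup>2) = ennreal (Jr n x * (cmod (u x))\<^sup>2)"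
      using AE_ennreal_Jr[of n] by eventually_elim (simp add: ennreal_mult)
  qed measurable
  finally show ?thesis .
qed

text \<open>The identity is stated weakly, through inner products, so that it exhibits
  multiplication by \<open>Jr (Suc n)\<close> as the representative required by the lemmas on
  \<open>L2_adjoint\<close>.\<close>

lemma L2_inner_W_Jr_W:
  assumes "f \<in> L2_space M" "g \<in> L2_space M"
  shows "L2_inner M (W f) (\<lambda>x. of_real (Jr n x) * W g x) = L2_inner M f (\<lambda>x. of_real (Jr (Suc n) x) * g x)"
proof -
  have [measurable]: "f \<in> borel_measurable M" "g \<in> borel_measurable M"
    using assms by (simp_all add: L2_space_measurable)
  let ?F = "\<lambda>x. f x * cnj (g x)"
  have "L2_inner M (W f) (\<lambda>x. of_real (Jr n x) * W g x) = (\<integral>x. (Jr n x * (cmod (u x))\<^sup>2) *\<^sub>R ?F (\<phi> x) \<partial>M)"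
    unfolding L2_inner_def
  proof (rule Bochner_Integration.integral_cong)
    fix x
    \<comment> \<open>The two copies of \<open>u\<close> combine to |u|^2 and what remains is
      \<open>?F\<close> composed with \<open>\<phi>\<close>, so the integral can be pushed forward
      along \<open>\<phi>\<close>.\<close>
    have "u x * cnj (u x) = of_real ((cmod (u x))\<^sup>2)"
      by (simp add: complex_norm_square[symmetric])
    then show "W f x * cnj (of_real (Jr n x) * W g x) = (Jr n x * (cmod (u x))\<^sup>2) *\<^sub>R ?F (\<phi> x)"
      by (simp add: weighted_comp_op_def scaleR_conv_of_real mult_ac)
  qed simp
  also have "\<dots> = (\<integral>x. ?F (\<phi> x) \<partial>density M (\<lambda>x. ennreal (Jr n x * (cmod (u x))\<^sup>2)))"
    by (rule integral_density[symmetric]) auto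
  also have "\<dots> = (\<integral>x. ?F x \<partial>density M (\<lambda>x. ennreal (Jr (Suc n) x)))"
    unfolding density_Jr_Suc by (rule integral_distr[symmetric]) auto
  also have "\<dots> = (\<integral>x. Jr (Suc n) x *\<^sub>R ?F x \<partial>M)"
    by (rule integral_density) auto
  also have "\<dots> = L2_inner M f (\<lambda>x. of_real (Jr (Suc n) x) * g x)"
    by (simp add: L2_inner_def scaleR_conv_of_real mult_ac)
  finally show ?thesis .
qed

section \<open>Powers of the adjoint and the defect operators as multiplications\<close>

lemma
  assumes "f \<in> L2_space M"
  shows adjoint_funpow_W_funpow_AE:
      "AE x in M. (L2_adjoint M W ^^ n) ((W ^^ n) f) x = of_real (Jr n x) * f x"
    and adjoint_funpow_W_funpow_L2: "(L2_adjoint M W ^^ n) ((W ^^ n) f) \<in> L2_space M"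
  using assms
\<comment> \<open>The induction hypothesis is used at \<open>W f\<close>, hence the generalisation
  over \<open>f\<close>. Both claims go together because replacing the argument of
  \<open>L2_adjoint\<close> requires its measurability.\<close>
proof (induction n arbitrary: f)
  case 0
  { case 1 show ?case by (simp add: Jr_def J_fun_def) }
  { case 2 then show ?case by simp }
next
  case (Suc n)
  \<comment> \<open>One \<open>W\<close> is moved innermost, so the hypothesis collapses the
    \<open>n\<close> inner pairs to a multiplication. This is an equality of functions, since
    \<open>L2_adjoint_cong\<close> absorbs the null set.\<close>
  have eq: "(L2_adjoint M W ^^ Suc n) ((W ^^ Suc n) f) = L2_adjoint M W (\<lambda>x. of_real (Jr n x) * W f x)"
    if f: "f \<in> L2_space M" for f
  proof -
    let ?v = "(L2_adjoint M W ^^ n) ((W ^^ n) (W f))"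
    have "(L2_adjoint M W ^^ Suc n) ((W ^^ Suc n) f) = L2_adjoint M W ?v"
      by (simp add: funpow_swap1)
    also have "\<dots> = L2_adjoint M W (\<lambda>x. of_real (Jr n x) * W f x)"
      using Suc.IH[OF W_L2[OF f]] Jr_mult_L2[OF W_L2[OF f]] W_L2
      by (intro L2_adjoint_cong) (auto simp: L2_space_measurable)
    finally show ?thesis .
  qed
  note adj = L2_adjoint_AE_eq[OF Jr_mult_L2 L2_inner_W_Jr_W] L2_adjoint_in_L2_space[OF Jr_mult_L2 L2_inner_W_Jr_W]
  { case 1 then show ?case unfolding eq[OF 1] by (intro adj) auto }
  { case 2 then show ?case unfolding eq[OF 2] by (intro adj(2)) auto }
qed

lemma isometry_defect_AE:
  assumes "f \<in> L2_space M"
  shows "AE x in M. isometry_defect M m W f x = of_real (G0_fun M \<phi> u m x) * f x"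
proof -
  have "AE x in M. \<forall>k\<in>{0..m}. (L2_adjoint M W ^^ k) ((W ^^ k) f) x = of_real (Jr k x) * f x"
    by (intro AE_finite_allI) (auto intro: adjoint_funpow_W_funpow_AE[OF assms])
  then show ?thesis
    by eventually_elim (simp add: isometry_defect_def G0_fun_def Jr_def sum_distrib_right mult.assoc)
qed

text \<open>Linearity of the adjoint is not invoked. The defect at \<open>W f\<close> is replaced by
  the explicit sum \<open>?S\<close>, and comparing inner products term by term shows that
  \<open>?R\<close> represents the adjoint at \<open>?S\<close>.\<close>

lemma adjoint_isometry_defect_AE:
  assumes f: "f \<in> L2_space M"
  shows "AE x in M. L2_adjoint M W (isometry_defect M m W (W f)) x = of_real (G_fun M \<phi> u m x) * f x"
proof -
  define c where "c k = (-1) ^ (m - k) * complex_of_nat (m choose k)" for k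
  \<comment> \<open>The inner product is conjugate-linear in its second argument, so the
    coefficients come out of it unchanged because they are real.\<close>
  have cnj_c: "cnj (c k) = c k" for k
    by (simp add: c_def)
  let ?S = "\<lambda>x. \<Sum>k=0..m. c k * (of_real (Jr k x) * W f x)"
  let ?R = "\<lambda>x. \<Sum>k=0..m. c k * (of_real (Jr (Suc k) x) * f x)"
  note L2 = L2_space_sum L2_space_cmult Jr_mult_L2 W_L2 f
  have S: "?S \<in> L2_space M" and R: "?R \<in> L2_space M"
    by (intro L2)+
  have "isometry_defect M m W (W f) \<in> L2_space M"
    unfolding isometry_defect_def by (intro L2_space_sum L2_space_cmult adjoint_funpow_W_funpow_L2 W_L2 f)
  moreover have "AE x in M. isometry_defect M m W (W f) x = ?S x"
    using isometry_defect_AE[OF W_L2[OF f], of m]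
    by eventually_elim (simp add: G0_fun_def Jr_def c_def sum_distrib_right mult.assoc)
  ultimately have "L2_adjoint M W (isometry_defect M m W (W f)) = L2_adjoint M W ?S"
    using S W_L2 by (intro L2_adjoint_cong) (auto simp: L2_space_measurable)
  moreover have "AE x in M. L2_adjoint M W ?S x = ?R x"
  proof (rule L2_adjoint_AE_eq[OF R])
    fix g assume g: "g \<in> L2_space M"
    have "L2_inner M (W g) ?S = (\<Sum>k=0..m. c k * L2_inner M (W g) (\<lambda>x. of_real (Jr k x) * W f x))"
      by (subst L2_inner_sum_right) (auto intro!: L2 g simp: L2_inner_cmult_right cnj_c)
    also have "\<dots> = (\<Sum>k=0..m. c k * L2_inner M g (\<lambda>x. of_real (Jr (Suc k) x) * f x))"
      by (simp only: L2_inner_W_Jr_W[OF g f])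
    also have "\<dots> = L2_inner M g ?R"
      by (subst L2_inner_sum_right) (auto intro!: L2 g simp: L2_inner_cmult_right cnj_c)
    finally show "L2_inner M (W g) ?S = L2_inner M g ?R" .
  qed
  moreover have "?R x = of_real (G_fun M \<phi> u m x) * f x" for x
    by (simp add: G_fun_def Jr_def c_def sum_distrib_right mult.assoc)
  ultimately show ?thesis
    by simp
qed

lemma m_isometry_iff: "m_isometry M m W \<longleftrightarrow> (AE x in M. G0_fun M \<phi> u m x = 0)"
proof -
  have "(AE x in M. isometry_defect M m W f x = 0) \<longleftrightarrow> (AE x in M. of_real (G0_fun M \<phi> u m x) * f x = 0)"
    if "f \<in> L2_space M" for f
    using isometry_defect_AE[OF that, of m] by (intro eventually_subst) (rule eventually_mono, auto)
  then show ?thesis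
    using bounded by (simp add: m_isometry_def flip: AE_eq_0_iff_L2_mult)
qed

lemma quasi_m_isometry_iff: "quasi_m_isometry M m W \<longleftrightarrow> (AE x in M. G_fun M \<phi> u m x = 0)"
proof -
  have "(AE x in M. L2_adjoint M W (isometry_defect M m W (W f)) x = 0)
      \<longleftrightarrow> (AE x in M. of_real (G_fun M \<phi> u m x) * f x = 0)"
    if "f \<in> L2_space M" for f
    using adjoint_isometry_defect_AE[OF that, of m] by (intro eventually_subst) (rule eventually_mono, auto)
  then show ?thesis
    using bounded by (simp add: quasi_m_isometry_def flip: AE_eq_0_iff_L2_mult)
qed

end

theorem theorem2p1:
  fixes M :: "'a measure" and \<phi> :: "'a \<Rightarrow> 'a" and u :: "'a \<Rightarrow> complex" and m :: nat
  assumes "sigma_finite_measure M"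
    and "nonsingular M \<phi>"
    and "\<And>n. n \<ge> 1 \<Longrightarrow> sigma_finite_subalgebra M (preimage_algebra M \<phi> n)"
    and "u \<in> borel_measurable M"
    and "\<And>x. x \<in> space M \<Longrightarrow> u x \<in> \<real>\<^sub>\<ge>\<^sub>0"
    and "L2_bounded_operator M (weighted_comp_op u \<phi>)"
  shows "(\<forall>n\<ge>1. AE x in M. J_fun M \<phi> u n x =
            RN_iter M \<phi> 1 x *
              cond_exp_pullback M \<phi> 1
                (\<lambda>y. J_fun M \<phi> u (n - 1) y * ennreal ((cmod (u y))\<^sup>2)) x) \<and>
         (quasi_m_isometry M m (weighted_comp_op u \<phi>) \<longleftrightarrow> (AE x in M. G_fun M \<phi> u m x = 0)) \<and>
         (m_isometry M m (weighted_comp_op u \<phi>) \<longleftrightarrow> (AE x in M. G0_fun M \<phi> u m x = 0))"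
proof -
  interpret bounded_weighted_comp_op M \<phi> u
    using assms by (intro bounded_weighted_comp_op.intro bounded_weighted_comp_op_axioms.intro)
  have "AE x in M. J_fun M \<phi> u n x = RN_iter M \<phi> 1 x *
      cond_exp_pullback M \<phi> 1 (\<lambda>y. J_fun M \<phi> u (n - 1) y * ennreal ((cmod (u y))\<^sup>2)) x"
    if "n \<ge> 1" for n
    using AE_J_Suc[of "n - 1"] that by simp
  then show ?thesis
    by (simp add: m_isometry_iff quasi_m_isometry_iff)
qed

end
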